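(* Let $G=(V,E)$ be an undirected graph on $n$ vertices with weight matrix $W$ and weighted Laplacian $L$, let $2\le k\le n-1$, let $m_1\ge\cdots\ge m_k\ge1$ be integers with $\sum_{j=1}^k m_j=n$, and let $\mathbf m=[m_1~\ldots~m_k]^\top$. Then the mixed-integer semidefinite program in the variables $P,X_1,X_2$ $$\min\;\tfrac12\langle L,X_1\rangle\quad\text{s.t.}\quad P\mathbf 1_k=\mathbf 1_n,\quad \operatorname{diag}(X_1)=\mathbf 1_n,\quad X_2=\operatorname{Diag}(\mathbf m),$$ $$\begin{pmatrix}\mathbf I_k&P^\top\\ P&X_1\end{pmatrix}\succeq\mathbf 0,\quad \begin{pmatrix}\mathbf I_n&P\\ P^\top&X_2\end{pmatrix}\succeq\mathbf 0,\quad X_1\in\mathcal S^n,\ X_2\in\mathcal S^k,\ P\in\{0,1\}^{n\times k}$$ is an exact formulation of the graph partition problem for $G$, $W$ and $\mathbf m$.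
   Context: $W=(w_{ij})\in\mathcal S^n$ is a real symmetric weight matrix with $w_{ij}=0$ if $\{i,j\}\notin E$, and $L=\operatorname{Diag}(W\mathbf 1_n)-W$, where $\operatorname{Diag}(v)$ is the diagonal matrix with diagonal $v$. The graph partition problem asks to partition $V$ into $k$ disjoint sets $S_1,\dots,S_k$ with $|S_j|=m_j$ for all $j$ such that the total weight of edges joining different sets is minimized. A program is an exact formulation of this problem if every such partition yields a feasible solution of the program whose objective value is the total weight of edges joining different sets, and every feasible solution of the program yields such a partition whose total weight equals the objective value. $\mathcal S^n$ is the set of real symmetric $n\times n$ matrices; $\mathbf 1_n$ is the all-ones vector; $\mathbf I_n$ is the identity matrix; $\langle X,Y\rangle=\operatorname{tr}(X^\top Y)$; $\succeq\mathbf 0$ means positive semidefinite; $\operatorname{diag}(X)$ is the vector of diagonal entries. *)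

theory Defs
  imports "Jordan_Normal_Form.Matrix" "HOL-Library.Disjoint_Sets"
begin

text \<open>Matrices, vertices (\<open>{..<n}\<close>) and parts (\<open>{..<k}\<close>) are indexed from \<open>0\<close>.\<close>

definition ones_vec :: "nat \<Rightarrow> real vec" where
  "ones_vec n = vec n (\<lambda>_. 1)"

definition diag_vec :: "real mat \<Rightarrow> real vec" where
  "diag_vec A = vec (dim_row A) (\<lambda>i. A $$ (i, i))"

definition Diag :: "real vec \<Rightarrow> real mat" where
  "Diag v = mat_diag (dim_vec v) (\<lambda>i. v $ i)"

definition trace :: "real mat \<Rightarrow> real" where
  "trace A = sum_list (diag_mat A)"

definition mat_inner :: "real mat \<Rightarrow> real mat \<Rightarrow> real" where
  "mat_inner X Y = trace (transpose_mat X * Y)"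

definition sym_mats :: "nat \<Rightarrow> real mat set" where
  "sym_mats n = {A \<in> carrier_mat n n. transpose_mat A = A}"

definition psd :: "real mat \<Rightarrow> bool" where
  "psd A \<longleftrightarrow> A \<in> sym_mats (dim_row A) \<and>
     (\<forall>x \<in> carrier_vec (dim_row A). 0 \<le> x \<bullet> (A *\<^sub>v x))"

text \<open>The edges are unordered pairs of vertices. Loops are not excluded; they never join different
  parts and cancel in the Laplacian.\<close>

definition undirected_graph :: "nat \<Rightarrow> nat set set \<Rightarrow> bool" where
  "undirected_graph n E \<longleftrightarrow> E \<subseteq> {{i, j} |i j. i < n \<and> j < n}"

definition weight_matrix :: "nat \<Rightarrow> nat set set \<Rightarrow> real mat \<Rightarrow> bool" where
  "weight_matrix n E W \<longleftrightarrow> W \<in> sym_mats n \<and>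
     (\<forall>i<n. \<forall>j<n. {i, j} \<notin> E \<longrightarrow> W $$ (i, j) = 0)"

definition laplacian :: "nat \<Rightarrow> real mat \<Rightarrow> real mat" where
  "laplacian n W = Diag (W *\<^sub>v ones_vec n) - W"

text \<open>A partition into \<open>k\<close> labelled parts \<open>S 0, \<dots>, S (k - 1)\<close> of prescribed sizes; the values
  of \<open>S\<close> and \<open>m\<close> at indices \<open>\<ge> k\<close> are irrelevant.\<close>

definition graph_partition :: "nat \<Rightarrow> nat \<Rightarrow> (nat \<Rightarrow> nat) \<Rightarrow> (nat \<Rightarrow> nat set) \<Rightarrow> bool" where
  "graph_partition n k m S \<longleftrightarrow>
     (\<Union>j<k. S j) = {..<n} \<and> disjoint_family_on S {..<k} \<and> (\<forall>j<k. card (S j) = m j)"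

definition cut_edges :: "nat set set \<Rightarrow> nat \<Rightarrow> (nat \<Rightarrow> nat set) \<Rightarrow> nat set set" where
  "cut_edges E k S =
     {e \<in> E. \<exists>a<k. \<exists>b<k. a \<noteq> b \<and> (\<exists>i\<in>S a. \<exists>j\<in>S b. e = {i, j})}"

text \<open>Every edge counts once; \<open>Min\<close> and \<open>Max\<close> only select its endpoints, in an order that is
  immaterial for symmetric \<open>W\<close>.\<close>

definition cut_weight ::
    "nat set set \<Rightarrow> real mat \<Rightarrow> nat \<Rightarrow> (nat \<Rightarrow> nat set) \<Rightarrow> real" where
  "cut_weight E W k S = (\<Sum>e\<in>cut_edges E k S. W $$ (Min e, Max e))"

text \<open>\<open>corresponds S x\<close> says which partition and which point of the program yield each other.\<close>

definition exact_formulation ::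
    "('s \<Rightarrow> bool) \<Rightarrow> ('s \<Rightarrow> real) \<Rightarrow> ('x \<Rightarrow> bool) \<Rightarrow> ('x \<Rightarrow> real)
      \<Rightarrow> ('s \<Rightarrow> 'x \<Rightarrow> bool) \<Rightarrow> bool" where
  "exact_formulation is_partition weight feasible objective corresponds \<longleftrightarrow>
     (\<forall>S. is_partition S \<longrightarrow>
        (\<exists>x. feasible x \<and> corresponds S x \<and> objective x = weight S)) \<and>
     (\<forall>x. feasible x \<longrightarrow>
        (\<exists>S. is_partition S \<and> corresponds S x \<and> weight S = objective x))"

fun misdp_feasible ::
    "nat \<Rightarrow> nat \<Rightarrow> (nat \<Rightarrow> nat) \<Rightarrow> real mat \<times> real mat \<times> real mat \<Rightarrow> bool" where
  "misdp_feasible n k m (P, X\<^sub>1, X\<^sub>2) \<longleftrightarrow>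
     P \<in> carrier_mat n k \<and> (\<forall>i<n. \<forall>j<k. P $$ (i, j) \<in> {0, 1}) \<and>
     X\<^sub>1 \<in> sym_mats n \<and> X\<^sub>2 \<in> sym_mats k \<and>
     P *\<^sub>v ones_vec k = ones_vec n \<and>
     diag_vec X\<^sub>1 = ones_vec n \<and>
     X\<^sub>2 = Diag (vec k (\<lambda>j. real (m j))) \<and>
     psd (four_block_mat (1\<^sub>m k) (transpose_mat P) P X\<^sub>1) \<and>
     psd (four_block_mat (1\<^sub>m n) P (transpose_mat P) X\<^sub>2)"

fun misdp_objective ::
    "nat \<Rightarrow> real mat \<Rightarrow> real mat \<times> real mat \<times> real mat \<Rightarrow> real" where
  "misdp_objective n W (P, X\<^sub>1, X\<^sub>2) = 1 / 2 * mat_inner (laplacian n W) X\<^sub>1"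

text \<open>\<open>P\<close> is the characteristic matrix of the partition \<open>S\<close>.\<close>

fun characteristic ::
    "nat \<Rightarrow> nat \<Rightarrow> (nat \<Rightarrow> nat set) \<Rightarrow> real mat \<times> real mat \<times> real mat \<Rightarrow> bool" where
  "characteristic n k S (P, X\<^sub>1, X\<^sub>2) \<longleftrightarrow>
     P = mat n k (\<lambda>(i, j). if i \<in> S j then 1 else 0)"

end

theory Submission
  imports Defs
begin

text \<open>By Schur complements the two matrix inequalities say that \<open>X\<^sub>1 - P P\<^sup>T\<close> and
  \<open>X\<^sub>2 - P\<^sup>T P\<close> are positive semidefinite. The row sums make the binary \<open>P\<close> the characteristic
  matrix of a partition into sets \<open>S\<^sub>j\<close>. The first complement then has zero diagonal, hence
  vanishes, so \<open>X\<^sub>1 = P P\<^sup>T\<close>. The diagonal of the second gives \<open>|S\<^sub>j| \<le> m\<^sub>j\<close>, and since both sides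
  sum to \<open>n\<close>, equality holds.\<close>

section \<open>Positive semidefinite matrices\<close>

lemma sum_list_upt: "sum_list (map f [0..<n]) = sum f {..<n}"
  by (metis interv_sum_list_conv_sum_set_nat lessThan_atLeast0 set_upt)

lemma mult_transpose_index:
  assumes "A \<in> carrier_mat p q" "i < p" "j < p"
  shows "(A * transpose_mat A) $$ (i, j) = (\<Sum>l<q. A $$ (i, l) * A $$ (j, l))"
  using assms by (auto simp: scalar_prod_def lessThan_atLeast0)

lemma transpose_mult_index:
  assumes "A \<in> carrier_mat p q" "i < q" "j < q"
  shows "(transpose_mat A * A) $$ (i, j) = (\<Sum>l<p. A $$ (l, i) * A $$ (l, j))"
  using assms by (auto simp: scalar_prod_def lessThan_atLeast0)

text \<open>Completing the square: the block form expands to \<open>x \<bullet> x\<close>, two equal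
  cross terms and \<open>y \<bullet> (Y *\<^sub>v y)\<close>. Adding the square of
  \<open>B *\<^sub>v y\<close> completes the first three to a full square, and subtracting it again
  turns \<open>Y\<close> into the Schur complement of the identity block.\<close>

lemma schur_quadratic_form:
  fixes B Y :: "real mat"
  assumes B: "B \<in> carrier_mat p q" and Y: "Y \<in> carrier_mat q q"
    and x: "x \<in> carrier_vec p" and y: "y \<in> carrier_vec q"
  shows "(x @\<^sub>v y) \<bullet> (four_block_mat (1\<^sub>m p) B (transpose_mat B) Y *\<^sub>v (x @\<^sub>v y)) =
    (x + B *\<^sub>v y) \<bullet> (x + B *\<^sub>v y) + y \<bullet> ((Y - transpose_mat B * B) *\<^sub>v y)"
proof -
  let ?z = "B *\<^sub>v y"
  have z: "?z \<in> carrier_vec p" and w: "transpose_mat B *\<^sub>v x \<in> carrier_vec q"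
    and v: "Y *\<^sub>v y \<in> carrier_vec q" and u: "transpose_mat B *\<^sub>v ?z \<in> carrier_vec q"
    using assms by auto
  have Bt: "transpose_mat B \<in> carrier_mat q p" using B by simp
  \<comment> \<open>Adjointness of \<open>B\<close> and its transpose serves twice:
    \<open>c = x\<close> matches the two cross terms, and \<open>c = ?z\<close> identifies the
    correction term as a square.\<close>
  have "y \<bullet> (transpose_mat B *\<^sub>v c) = ?z \<bullet> c" if c: "c \<in> carrier_vec p" for c
    using transpose_vec_mult_scalar[OF Bt c y] by simp
  then have adj: "y \<bullet> (transpose_mat B *\<^sub>v x) = ?z \<bullet> x" "y \<bullet> (transpose_mat B *\<^sub>v ?z) = ?z \<bullet> ?z"
    using x z by auto
  have "(x @\<^sub>v y) \<bullet> (four_block_mat (1\<^sub>m p) B (transpose_mat B) Y *\<^sub>v (x @\<^sub>v y)) =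
    x \<bullet> (x + ?z) + y \<bullet> (transpose_mat B *\<^sub>v x + Y *\<^sub>v y)"
    using x y z w v B
    by (subst four_block_mat_mult_vec[OF _ B Bt Y x y])
      (auto intro!: scalar_prod_append)
  also have "\<dots> = x \<bullet> x + x \<bullet> ?z + ?z \<bullet> x + y \<bullet> (Y *\<^sub>v y)"
    using adj by (simp add: scalar_prod_add_distrib[OF x x z] scalar_prod_add_distrib[OF y w v])
  also have "\<dots> = (x + ?z) \<bullet> (x + ?z) + (y \<bullet> (Y *\<^sub>v y) - ?z \<bullet> ?z)"
    using x z by (simp add: scalar_prod_add_distrib[of _ p] add_scalar_prod_distrib[of _ p])
  also have "y \<bullet> (Y *\<^sub>v y) - ?z \<bullet> ?z = y \<bullet> ((Y - transpose_mat B * B) *\<^sub>v y)"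
    using B y
    by (simp add: minus_mult_distrib_mat_vec[OF Y mult_carrier_mat[OF Bt B]]
        scalar_prod_minus_distrib[OF y v u] adj(2) assoc_mult_mat_vec[OF Bt B])
  finally show ?thesis .
qed

text \<open>The square in \<open>schur_quadratic_form\<close> is nonnegative and can be made zero by
  a choice of \<open>x\<close>, so only the form of the complement in \<open>y\<close> decides the
  sign. Both semidefinite constraints of the program are instances: \<open>B\<close> is the
  transpose of \<open>P\<close> with \<open>Y\<close> equal to \<open>X\<^sub>1\<close>, or
  \<open>B\<close> is \<open>P\<close> with \<open>Y\<close> equal to
  \<open>X\<^sub>2\<close>.\<close>

lemma schur_complement_psd_iff:
  fixes B Y :: "real mat"
  assumes B: "B \<in> carrier_mat p q" and Y: "Y \<in> sym_mats q"
  shows "psd (four_block_mat (1\<^sub>m p) B (transpose_mat B) Y) \<longleftrightarrow> psd (Y - transpose_mat B * B)"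
proof -
  let ?M = "four_block_mat (1\<^sub>m p) B (transpose_mat B) Y" and ?C = "Y - transpose_mat B * B"
  have Yc: "Y \<in> carrier_mat q q" and Yt: "transpose_mat Y = Y" using Y by (auto simp: sym_mats_def)
  have Mc: "?M \<in> carrier_mat (p + q) (p + q)" using Yc by simp
  have "transpose_mat ?M = ?M"
    using transpose_four_block_mat[of "1\<^sub>m p" p p B q "transpose_mat B" q Y] B Yc Yt by simp
  with Mc have Ms: "?M \<in> sym_mats (p + q)" by (simp add: sym_mats_def)
  have Cc: "?C \<in> carrier_mat q q" using B by (auto intro: minus_carrier_mat)
  have "transpose_mat ?C = ?C"
    using transpose_minus[OF Yc, of "transpose_mat B * B"] transpose_mult[of "transpose_mat B" q p B q] B Yt
    by simp
  with Cc have Cs: "?C \<in> sym_mats q" by (simp add: sym_mats_def)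
  note form = schur_quadratic_form[OF B Yc]
  \<comment> \<open>Every vector of dimension \<open>p + q\<close> splits as
    \<open>x @\<^sub>v y\<close> (\<open>all_vec_append\<close>), so the left side is the form
    condition for \<open>?M\<close>.\<close>
  have "(\<forall>x\<in>carrier_vec p. \<forall>y\<in>carrier_vec q. 0 \<le> (x @\<^sub>v y) \<bullet> (?M *\<^sub>v (x @\<^sub>v y))) \<longleftrightarrow>
    (\<forall>y\<in>carrier_vec q. 0 \<le> y \<bullet> (?C *\<^sub>v y))" (is "?l \<longleftrightarrow> ?r")
  proof
    assume ?l
    show ?r
    proof
      fix y :: "real vec" assume y: "y \<in> carrier_vec q"
      have By: "B *\<^sub>v y \<in> carrier_vec p" "- (B *\<^sub>v y) \<in> carrier_vec p" using B y by auto
      \<comment> \<open>The minimizing choice \<open>x = - (B *\<^sub>v y)\<close> annihilates the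
        square and leaves exactly the form of the complement.\<close>
      have "- (B *\<^sub>v y) + B *\<^sub>v y = 0\<^sub>v p" using By by auto
      with \<open>?l\<close> y By form[OF By(2) y] show "0 \<le> y \<bullet> (?C *\<^sub>v y)" by fastforce
    qed
  next
    assume ?r
    have "0 \<le> v \<bullet> v" for v :: "real vec" by (simp add: scalar_prod_def sum_nonneg)
    with \<open>?r\<close> show ?l by (simp add: form)
  qed
  moreover have "dim_row ?M = p + q" "dim_row ?C = q" using Mc Cc by (auto simp only: carrier_matD)
  ultimately show ?thesis
    using Ms Cs by (simp only: psd_def all_vec_append simp_thms)
qed

lemma psd_diag_nonneg:
  assumes psd: "psd A" and A: "A \<in> carrier_mat n n" and i: "i < n"
  shows "0 \<le> A $$ (i, i)"
proof -
  have "unit_vec n i \<bullet> (A *\<^sub>v unit_vec n i) = A $$ (i, i)"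
    using i A by (subst scalar_prod_left_unit[of _ n]) auto
  moreover have "0 \<le> unit_vec n i \<bullet> (A *\<^sub>v unit_vec n i)"
    using psd A by (auto simp: psd_def)
  ultimately show ?thesis by simp
qed

text \<open>With a zero diagonal, the form at \<open>unit_vec n i\<close> plus \<open>t\<close>
  times \<open>unit_vec n j\<close> has no square terms and is linear in \<open>t\<close>. Being
  nonnegative at both \<open>t = 1\<close> and \<open>t = -1\<close>, it has slope zero.\<close>

lemma psd_zero_diag:
  assumes psd: "psd A" and A: "A \<in> carrier_mat n n"
    and diag: "\<And>i. i < n \<Longrightarrow> A $$ (i, i) = 0"
  shows "A = 0\<^sub>m n n"
proof (rule eq_matI)
  fix i j assume "i < dim_row (0\<^sub>m n n :: real mat)" "j < dim_col (0\<^sub>m n n :: real mat)"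
  then have ij: "i < n" "j < n" by simp_all
  have "transpose_mat A = A" and pos: "\<And>x. x \<in> carrier_vec n \<Longrightarrow> 0 \<le> x \<bullet> (A *\<^sub>v x)"
    using psd A by (auto simp: psd_def sym_mats_def)
  then have sym: "A $$ (j, i) = A $$ (i, j)" using A ij by (metis carrier_matD index_transpose_mat(1))
  have "0 \<le> 2 * t * A $$ (i, j)" for t
  proof -
    let ?u = "unit_vec n i :: real vec" and ?v = "unit_vec n j :: real vec"
    have Au: "A *\<^sub>v ?u \<in> carrier_vec n" "A *\<^sub>v ?v \<in> carrier_vec n" using A by auto
    have e: "(A *\<^sub>v ?u) $ i = 0" "(A *\<^sub>v ?u) $ j = A $$ (i, j)"
      "(A *\<^sub>v ?v) $ i = A $$ (i, j)" "(A *\<^sub>v ?v) $ j = 0"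
      using A ij diag sym by auto
    have m: "A *\<^sub>v (?u + t \<cdot>\<^sub>v ?v) = A *\<^sub>v ?u + t \<cdot>\<^sub>v (A *\<^sub>v ?v)"
      by (simp add: mult_add_distrib_mat_vec[OF A] mult_mat_vec[OF A])
    have "(?u + t \<cdot>\<^sub>v ?v) \<bullet> (A *\<^sub>v (?u + t \<cdot>\<^sub>v ?v)) = 2 * t * A $$ (i, j)"
      unfolding m using A Au ij e
      by (simp add: add_scalar_prod_distrib[of _ n] scalar_prod_left_unit[of _ n])
    then show ?thesis using pos[of "?u + t \<cdot>\<^sub>v ?v"] by simp
  qed
  from this[of 1] this[of "-1"] show "A $$ (i, j) = 0\<^sub>m n n $$ (i, j)" using ij by simp
qed (use A in auto)

section \<open>Characteristic matrices of partitions\<close>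

text \<open>The matrix from \<open>characteristic\<close> under a name of its own, so that its two
  Gram products can be studied.\<close>

definition char_mat :: "nat \<Rightarrow> nat \<Rightarrow> (nat \<Rightarrow> nat set) \<Rightarrow> real mat" where
  "char_mat n k S = mat n k (\<lambda>(i, j). if i \<in> S j then 1 else 0)"

lemma char_mat_carrier [simp]: "char_mat n k S \<in> carrier_mat n k"
  by (simp add: char_mat_def)

lemma char_mat_index [simp]:
  "i < n \<Longrightarrow> j < k \<Longrightarrow> char_mat n k S $$ (i, j) = of_bool (i \<in> S j)"
  by (simp add: char_mat_def)

lemma graph_partition_unique:
  "graph_partition n k m S \<Longrightarrow> a < k \<Longrightarrow> b < k \<Longrightarrow> i \<in> S a \<Longrightarrow> i \<in> S b \<Longrightarrow> a = b"
  by (auto simp: graph_partition_def disjoint_family_on_def)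

text \<open>Membership of a fixed vertex becomes the equation \<open>b = a\<close>, which collapses
  sums over the parts to a single term.\<close>

lemma graph_partitionE:
  assumes "graph_partition n k m S" "i < n"
  obtains a where "a < k" "i \<in> S a" "\<And>b. b < k \<Longrightarrow> i \<in> S b \<longleftrightarrow> b = a"
proof -
  from assms obtain a where a: "a < k" "i \<in> S a" by (auto simp: graph_partition_def)
  moreover have "i \<in> S b \<longleftrightarrow> b = a" if "b < k" for b
    using graph_partition_unique[OF assms(1)] a that by blast
  ultimately show ?thesis using that by blast
qed

lemma graph_partition_subset:
  "graph_partition n k m S \<Longrightarrow> a < k \<Longrightarrow> S a \<subseteq> {..<n}"
  by (auto simp: graph_partition_def)

lemma char_mat_row_sum:
  assumes "graph_partition n k m S"
  shows "char_mat n k S *\<^sub>v ones_vec k = ones_vec n"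
proof (rule eq_vecI)
  fix i assume "i < dim_vec (ones_vec n)"
  then have i: "i < n" by (simp add: ones_vec_def)
  with assms obtain a where a: "a < k" "i \<in> S a" "\<And>b. b < k \<Longrightarrow> i \<in> S b \<longleftrightarrow> b = a"
    by (rule graph_partitionE) blast
  have "(\<Sum>b<k. of_bool (i \<in> S b)) = (\<Sum>b<k. if b = a then 1 else 0 :: real)"
    using a(3) by (intro sum.cong) auto
  also have "\<dots> = 1" using a(1) by simp
  finally show "(char_mat n k S *\<^sub>v ones_vec k) $ i = ones_vec n $ i"
    using i by (simp add: ones_vec_def char_mat_def scalar_prod_def lessThan_atLeast0 of_bool_def)
qed (simp_all add: ones_vec_def char_mat_def)

text \<open>The entry counts the parts that contain both vertices; disjointness bounds this count by
  one.\<close>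

lemma char_mat_mult_transpose:
  assumes S: "graph_partition n k m S" and ij: "i < n" "j < n"
  shows "(char_mat n k S * transpose_mat (char_mat n k S)) $$ (i, j) =
    of_bool (\<exists>a<k. i \<in> S a \<and> j \<in> S a)"
proof -
  from S ij(1) obtain a where a: "a < k" "i \<in> S a" "\<And>b. b < k \<Longrightarrow> i \<in> S b \<longleftrightarrow> b = a"
    by (rule graph_partitionE) blast
  have "(char_mat n k S * transpose_mat (char_mat n k S)) $$ (i, j) =
    (\<Sum>b<k. of_bool (i \<in> S b) * of_bool (j \<in> S b))"
    using ij by (subst mult_transpose_index[OF char_mat_carrier]) simp_all
  also have "\<dots> = (\<Sum>b<k. if b = a then of_bool (j \<in> S a) else 0)"
    using a(3) by (intro sum.cong) auto
  also have "\<dots> = of_bool (\<exists>b<k. i \<in> S b \<and> j \<in> S b)" using a by auto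
  finally show ?thesis .
qed

text \<open>The entry at \<open>(a, b)\<close> is the size of \<open>S a \<inter> S b\<close>:
  disjointness clears the off-diagonal entries, and the prescribed sizes give the diagonal.\<close>

lemma char_mat_transpose_mult:
  assumes S: "graph_partition n k m S"
  shows "transpose_mat (char_mat n k S) * char_mat n k S = Diag (vec k (\<lambda>j. real (m j)))"
proof (rule eq_matI)
  fix a b assume "a < dim_row (Diag (vec k (\<lambda>j. real (m j))))" "b < dim_col (Diag (vec k (\<lambda>j. real (m j))))"
  then have ab: "a < k" "b < k" by (auto simp: Diag_def mat_diag_def)
  have "(transpose_mat (char_mat n k S) * char_mat n k S) $$ (a, b) =
    (\<Sum>i<n. of_bool (i \<in> S a) * of_bool (i \<in> S b))"
    using ab by (subst transpose_mult_index[OF char_mat_carrier]) simp_all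
  also have "\<dots> = (\<Sum>i<n. of_bool (i \<in> S a \<inter> S b))" by (intro sum.cong) auto
  also have "\<dots> = real (card (S a \<inter> S b))"
    using graph_partition_subset[OF S ab(1)] by (auto intro!: arg_cong[of _ _ card])
  also have "\<dots> = (if a = b then real (m b) else 0)"
    using S ab by (auto simp: graph_partition_def disjoint_family_on_def)
  finally show "(transpose_mat (char_mat n k S) * char_mat n k S) $$ (a, b) =
    Diag (vec k (\<lambda>j. real (m j))) $$ (a, b)"
    using ab by (simp add: Diag_def mat_diag_def)
qed (simp_all add: Diag_def mat_diag_def char_mat_def)

section \<open>The objective\<close>

lemma mat_inner_eq_sum:
  assumes "X \<in> carrier_mat n n" "Y \<in> carrier_mat n n"
  shows "mat_inner X Y = (\<Sum>i<n. \<Sum>j<n. X $$ (i, j) * Y $$ (i, j))"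
proof -
  have "mat_inner X Y = (\<Sum>j<n. \<Sum>i<n. X $$ (i, j) * Y $$ (i, j))"
    using assms by (simp add: mat_inner_def trace_def diag_mat_def sum_list_upt scalar_prod_def lessThan_atLeast0)
  also have "\<dots> = (\<Sum>i<n. \<Sum>j<n. X $$ (i, j) * Y $$ (i, j))" by (rule sum.swap)
  finally show ?thesis .
qed

text \<open>Since \<open>X\<close> has unit diagonal, the diagonal part of the Laplacian contributes
  the plain row sums of \<open>W\<close>, which merge termwise with the contribution of
  \<open>- W\<close>.\<close>

lemma laplacian_inner:
  assumes W: "W \<in> carrier_mat n n" and X: "X \<in> carrier_mat n n"
    and diag: "\<And>i. i < n \<Longrightarrow> X $$ (i, i) = 1"
  shows "mat_inner (laplacian n W) X = (\<Sum>i<n. \<Sum>j<n. W $$ (i, j) * (1 - X $$ (i, j)))"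
proof -
  have L: "laplacian n W $$ (i, j) = (if i = j then (\<Sum>l<n. W $$ (i, l)) else 0) - W $$ (i, j)"
    if "i < n" "j < n" for i j
    using W that
    by (auto simp: laplacian_def Diag_def mat_diag_def ones_vec_def scalar_prod_def lessThan_atLeast0)
  have Lc: "laplacian n W \<in> carrier_mat n n" using W by (auto simp: laplacian_def intro: minus_carrier_mat)
  have "(\<Sum>j<n. laplacian n W $$ (i, j) * X $$ (i, j)) = (\<Sum>j<n. W $$ (i, j) * (1 - X $$ (i, j)))"
    if i: "i < n" for i
  proof -
    have "(\<Sum>j<n. laplacian n W $$ (i, j) * X $$ (i, j)) =
      (\<Sum>j<n. (if i = j then \<Sum>l<n. W $$ (i, l) else 0) - W $$ (i, j) * X $$ (i, j))"
      using i by (intro sum.cong) (auto simp: L diag algebra_simps)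
    also have "\<dots> = (\<Sum>j<n. W $$ (i, j) * (1 - X $$ (i, j)))"
      using i by (simp add: sum_subtractf algebra_simps)
    finally show ?thesis .
  qed
  then show ?thesis by (simp add: mat_inner_eq_sum[OF Lc X])
qed

text \<open>The right side sums \<open>W\<close> over ordered pairs of vertices in different parts,
  so each cut edge occurs twice, once per orientation. This factor 2 cancels the
  \<open>1 / 2\<close> in the objective.\<close>

lemma cut_weight_eq_sum:
  assumes W: "weight_matrix n E W" and S: "graph_partition n k m S"
  shows "2 * cut_weight E W k S =
    (\<Sum>i<n. \<Sum>j<n. W $$ (i, j) * (1 - of_bool (\<exists>a<k. i \<in> S a \<and> j \<in> S a)))"
proof -
  let ?same = "\<lambda>i j. \<exists>a<k. i \<in> S a \<and> j \<in> S a"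
  \<comment> \<open>\<open>D\<close> holds the ordered pairs separated by the partition, and
    \<open>U\<close> picks from each such unordered pair the orientation with the smaller vertex
    first.\<close>
  define D where "D = {(i, j). i < n \<and> j < n \<and> \<not> ?same i j}"
  define U where "U = {(i, j) \<in> D. i < j}"
  let ?W = "\<lambda>(i, j). W $$ (i, j)"
  have fin: "finite D" by (rule finite_subset[of _ "{..<n} \<times> {..<n}"]) (auto simp: D_def)
  then have finU: "finite U" by (rule rev_finite_subset) (auto simp: U_def)
  have Wsym: "W $$ (j, i) = W $$ (i, j)" if "i < n" "j < n" for i j
    proof -
    have "W \<in> carrier_mat n n" "transpose_mat W = W"
      using W by (auto simp: weight_matrix_def sym_mats_def)
    then show ?thesis using that by (metis carrier_matD index_transpose_mat(1))
  qed
  have same_iff: "?same i j \<longleftrightarrow> a = b" if "i \<in> S a" "j \<in> S b" "a < k" "b < k" for i j a b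
    using graph_partition_unique[OF S] that by metis
  have irrefl: "(i, i) \<notin> D" for i
    using S by (auto simp: D_def elim: graph_partitionE)
  have "(\<Sum>i<n. \<Sum>j<n. W $$ (i, j) * (1 - of_bool (?same i j))) =
    (\<Sum>p\<in>{..<n} \<times> {..<n}. case p of (i, j) \<Rightarrow> W $$ (i, j) * (1 - of_bool (?same i j)))"
    by (simp add: sum.cartesian_product)
  also have "\<dots> = sum ?W D"
    by (rule sum.mono_neutral_cong_right) (auto simp: D_def)
  \<comment> \<open>Separation is symmetric, and no pair \<open>(i, i)\<close> is separated because
    every vertex lies in some part; so \<open>D\<close> is \<open>U\<close> together with its mirror
    image.\<close>
  also have "D = U \<union> prod.swap ` U"
  proof -
    have "p \<in> D \<longleftrightarrow> p \<in> U \<union> prod.swap ` U" for p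
    proof -
      obtain i j where p: "p = (i, j)" by (cases p)
      have "(i, j) \<in> prod.swap ` U \<longleftrightarrow> (j, i) \<in> U" by (metis pair_in_swap_image)
      moreover have "(i, j) \<in> D \<longleftrightarrow> (j, i) \<in> D" by (auto simp: D_def)
      ultimately show ?thesis using irrefl[of i] by (cases i j rule: linorder_cases) (auto simp: p U_def)
    qed
    then show ?thesis by blast
  qed
  also have "sum ?W \<dots> = sum ?W U + sum ?W (prod.swap ` U)"
    using finU by (intro sum.union_disjoint) (auto simp: U_def)
  also have "sum ?W (prod.swap ` U) = sum ?W U"
    by (subst sum.reindex) (auto simp: U_def D_def Wsym intro!: sum.cong)
  also have "sum ?W U = cut_weight E W k S"
  proof -
    \<comment> \<open>Ordering the endpoints makes the passage from pairs to edges injective, so the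
      sum over cut edges can be reindexed by pairs.\<close>
    have inj: "inj_on (\<lambda>(i, j). {i, j}) U" by (auto simp: inj_on_def U_def doubleton_eq_iff)
    have "cut_edges E k S = (\<lambda>(i, j). {i, j}) ` {(i, j) \<in> U. {i, j} \<in> E}" (is "_ = ?R")
    proof (intro equalityI subsetI)
      fix e assume "e \<in> cut_edges E k S"
      then obtain a b i j where e: "e \<in> E" "a < k" "b < k" "a \<noteq> b" "i \<in> S a" "j \<in> S b" "e = {i, j}"
        by (auto simp: cut_edges_def)
      have lt: "i < n" "j < n" using graph_partition_subset[OF S] e by auto
      have ns: "\<not> ?same i j" "\<not> ?same j i"
        using same_iff[OF e(5,6,2,3)] same_iff[OF e(6,5,3,2)] e(4) by blast+
      have "i \<noteq> j" using ns e by auto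
      then consider "i < j" | "j < i" by linarith
      then show "e \<in> ?R"
      proof cases
        case 1
        then have "(i, j) \<in> U" using lt ns by (simp add: U_def D_def)
        then show ?thesis using e by (intro image_eqI[of _ _ "(i, j)"]) auto
      next
        case 2
        then have "(j, i) \<in> U" using lt ns by (simp add: U_def D_def)
        then show ?thesis using e by (intro image_eqI[of _ _ "(j, i)"]) (auto simp: insert_commute)
      qed
    next
      fix e assume "e \<in> ?R"
      then obtain i j where e: "e \<in> E" "e = {i, j}" "(i, j) \<in> U" by auto
      then have "i < n" "j < n" and ns: "\<not> ?same i j" by (auto simp: U_def D_def)
      obtain a where a: "a < k" "i \<in> S a" by (rule graph_partitionE[OF S \<open>i < n\<close>])
      obtain b where b: "b < k" "j \<in> S b" by (rule graph_partitionE[OF S \<open>j < n\<close>])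
      have "a \<noteq> b" using same_iff[OF a(2) b(2) a(1) b(1)] ns by simp
      with a b e show "e \<in> cut_edges E k S" unfolding cut_edges_def by blast
    qed
    then have "cut_weight E W k S =
      (\<Sum>e\<in>(\<lambda>(i, j). {i, j}) ` {(i, j) \<in> U. {i, j} \<in> E}. W $$ (Min e, Max e))"
      by (simp add: cut_weight_def)
    also have "\<dots> = (\<Sum>(i, j)\<in>{(i, j) \<in> U. {i, j} \<in> E}. W $$ (Min {i, j}, Max {i, j}))"
      by (subst sum.reindex) (auto intro: inj_on_subset[OF inj] sum.cong)
    \<comment> \<open>On \<open>U\<close> the first component is the smaller one, so
      \<open>Min\<close> and \<open>Max\<close> return \<open>i\<close> and \<open>j\<close> in this
      order.\<close>
    also have "\<dots> = sum ?W {(i, j) \<in> U. {i, j} \<in> E}"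
      by (rule sum.cong) (auto simp: U_def)
    \<comment> \<open>Pairs of \<open>U\<close> that are not edges have weight zero and may be
      added.\<close>
    also have "\<dots> = sum ?W U"
      using finU W by (intro sum.mono_neutral_left) (auto simp: U_def D_def weight_matrix_def)
    finally show ?thesis by simp
  qed
  finally show ?thesis by simp
qed

lemma misdp_objective_char_mat:
  assumes W: "weight_matrix n E W" and S: "graph_partition n k m S"
  shows "misdp_objective n W (P, char_mat n k S * transpose_mat (char_mat n k S), X\<^sub>2) =
    cut_weight E W k S"
proof -
  let ?X = "char_mat n k S * transpose_mat (char_mat n k S)"
  have Wc: "W \<in> carrier_mat n n" using W by (simp add: weight_matrix_def sym_mats_def)
  have X: "?X \<in> carrier_mat n n" by (rule mult_carrier_mat[of _ n k]) auto
  have "?X $$ (i, i) = 1" if "i < n" for i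
    using char_mat_mult_transpose[OF S that that] graph_partitionE[OF S that] by auto
  then have "mat_inner (laplacian n W) ?X = (\<Sum>i<n. \<Sum>j<n. W $$ (i, j) * (1 - ?X $$ (i, j)))"
    by (rule laplacian_inner[OF Wc X])
  also have "\<dots> = 2 * cut_weight E W k S"
    unfolding cut_weight_eq_sum[OF assms] by (intro sum.cong refl) (simp add: char_mat_mult_transpose[OF S])
  finally show ?thesis by simp
qed

section \<open>Feasible points\<close>

lemma Diag_sym: "Diag v \<in> sym_mats (dim_vec v)"
  by (auto simp: Diag_def sym_mats_def mat_diag_def intro!: eq_matI)

lemma mult_transpose_sym: "A \<in> carrier_mat p q \<Longrightarrow> A * transpose_mat A \<in> sym_mats p"
  by (auto simp: sym_mats_def transpose_mult[of A p q "transpose_mat A" p])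

lemma psd_zero: "psd (0\<^sub>m n n)"
  by (auto simp: psd_def sym_mats_def scalar_prod_def intro!: sum_nonneg)

text \<open>Both Schur complements are the zero matrix: the first by the choice of the middle
  component, the second by \<open>char_mat_transpose_mult\<close>.\<close>

lemma char_mat_feasible:
  assumes S: "graph_partition n k m S"
  shows "misdp_feasible n k m (char_mat n k S,
    char_mat n k S * transpose_mat (char_mat n k S), Diag (vec k (\<lambda>j. real (m j))))"
proof -
  let ?P = "char_mat n k S" and ?D = "Diag (vec k (\<lambda>j. real (m j)))"
  let ?X = "?P * transpose_mat ?P"
  have P: "?P \<in> carrier_mat n k" and Pt: "transpose_mat ?P \<in> carrier_mat k n" by auto
  have X: "?X \<in> sym_mats n" by (rule mult_transpose_sym[OF P])
  then have Xc: "?X \<in> carrier_mat n n" by (simp add: sym_mats_def)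
  have D: "?D \<in> sym_mats k" using Diag_sym[of "vec k (\<lambda>j. real (m j))"] by simp
  then have Dc: "?D \<in> carrier_mat k k" by (simp add: sym_mats_def)
  have "?X $$ (i, i) = 1" if "i < n" for i
    using char_mat_mult_transpose[OF S that that] graph_partitionE[OF S that] by auto
  then have diag: "diag_vec ?X = ones_vec n" using carrier_matD(1)[OF Xc] by (auto simp only: diag_vec_def ones_vec_def index_vec dim_vec intro!: eq_vecI)
  have "psd (four_block_mat (1\<^sub>m k) (transpose_mat ?P) ?P ?X)"
    using schur_complement_psd_iff[OF Pt X] minus_r_inv_mat[OF Xc] by (simp add: psd_zero)
  moreover have "psd (four_block_mat (1\<^sub>m n) ?P (transpose_mat ?P) ?D)"
    using schur_complement_psd_iff[OF P D] minus_r_inv_mat[OF Dc]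
    by (simp add: psd_zero char_mat_transpose_mult[OF S])
  ultimately show ?thesis
    using X D diag char_mat_row_sum[OF S] by simp
qed

text \<open>Besides the partition, the middle component is determined; this is what allows
  \<open>misdp_objective_char_mat\<close> to evaluate the objective at an arbitrary feasible
  point.\<close>

lemma feasible_imp_char_mat:
  assumes feas: "misdp_feasible n k m (P, X\<^sub>1, X\<^sub>2)" and sum_m: "(\<Sum>j<k. m j) = n"
  obtains S where "graph_partition n k m S" "P = char_mat n k S"
    "X\<^sub>1 = char_mat n k S * transpose_mat (char_mat n k S)"
proof -
  have P: "P \<in> carrier_mat n k" and bin: "\<And>i j. i < n \<Longrightarrow> j < k \<Longrightarrow> P $$ (i, j) \<in> {0, 1}"
    and X1: "X\<^sub>1 \<in> sym_mats n" and X2: "X\<^sub>2 \<in> sym_mats k"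
    and rows: "P *\<^sub>v ones_vec k = ones_vec n" and diag: "diag_vec X\<^sub>1 = ones_vec n"
    and X2D: "X\<^sub>2 = Diag (vec k (\<lambda>j. real (m j)))"
    and psd1: "psd (four_block_mat (1\<^sub>m k) (transpose_mat P) P X\<^sub>1)"
    and psd2: "psd (four_block_mat (1\<^sub>m n) P (transpose_mat P) X\<^sub>2)"
    using feas by auto
  have Pt: "transpose_mat P \<in> carrier_mat k n" using P by simp
  have C1: "psd (X\<^sub>1 - P * transpose_mat P)"
    using schur_complement_psd_iff[OF Pt X1] psd1 by simp
  have C2: "psd (X\<^sub>2 - transpose_mat P * P)"
    using schur_complement_psd_iff[OF P X2] psd2 by simp
  \<comment> \<open>Part \<open>j\<close> is the support of column \<open>j\<close>, which
    determines the column because \<open>P\<close> is binary.\<close>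
  define S where "S j = {i. i < n \<and> P $$ (i, j) = 1}" for j
  have P_eq: "P = char_mat n k S"
    using P bin by (intro eq_matI) (auto simp: char_mat_def S_def)
  \<comment> \<open>A row sum of a binary matrix counts the ones in the row, here the parts
    containing vertex \<open>i\<close>. Count one yields both covering and disjointness.\<close>
  have row_sum: "card {j. j < k \<and> i \<in> S j} = 1" if i: "i < n" for i
  proof -
    have "(\<Sum>j<k. P $$ (i, j)) = 1"
      using arg_cong[OF rows, of "\<lambda>v. v $ i"] i P
      by (simp add: ones_vec_def scalar_prod_def lessThan_atLeast0)
    moreover have "(\<Sum>j<k. P $$ (i, j)) = (\<Sum>j<k. of_bool (i \<in> S j))"
      using i by (intro sum.cong) (auto simp: P_eq)
    moreover have "(\<Sum>j<k. of_bool (i \<in> S j) :: real) = real (card {j. j < k \<and> i \<in> S j})"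
      by (simp add: Int_def)
    ultimately show ?thesis by simp
  qed
  have cover: "(\<Union>j<k. S j) = {..<n}"
  proof (intro equalityI subsetI)
    fix i assume "i \<in> {..<n}"
    then have "{j. j < k \<and> i \<in> S j} \<noteq> {}" using row_sum[of i] by force
    then show "i \<in> (\<Union>j<k. S j)" by auto
  qed (auto simp: S_def)
  have disj: "disjoint_family_on S {..<k}"
  unfolding disjoint_family_on_def
  proof (intro ballI impI)
    fix a b assume ab: "a \<in> {..<k}" "b \<in> {..<k}" "a \<noteq> b"
    show "S a \<inter> S b = {}"
    proof (rule ccontr)
      assume "S a \<inter> S b \<noteq> {}"
      then obtain i where i: "i \<in> S a" "i \<in> S b" by auto
      then have "i < n" by (simp add: S_def)
      from row_sum[OF this] obtain c where c: "{j. j < k \<and> i \<in> S j} = {c}" by (rule card_1_singletonE)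
      have "a \<in> {c}" "b \<in> {c}" using ab i unfolding c[symmetric] by auto
      with ab show False by simp
    qed
  qed
  have sum_card: "(\<Sum>j<k. card (S j)) = n"
    using card_UN_disjoint[of "{..<k}" S] disj cover
    by (simp add: disjoint_family_on_def S_def)
  \<comment> \<open>The \<open>j\<close>-th diagonal entry of the second Schur complement is
    \<open>m j\<close> minus the size of \<open>S j\<close>, and it is nonnegative.\<close>
  have card_le: "card (S j) \<le> m j" if j: "j < k" for j
  proof -
    have "X\<^sub>2 - transpose_mat P * P \<in> carrier_mat k k" using P by (auto intro: minus_carrier_mat)
    then have "0 \<le> (X\<^sub>2 - transpose_mat P * P) $$ (j, j)" using psd_diag_nonneg[OF C2] j by blast
    also have "\<dots> = X\<^sub>2 $$ (j, j) - (transpose_mat P * P) $$ (j, j)" using P j by simp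
    also have "X\<^sub>2 $$ (j, j) = m j" using j by (simp add: X2D Diag_def mat_diag_def)
    also have "(transpose_mat P * P) $$ (j, j) = (\<Sum>i<n. of_bool (i \<in> S j))"
      unfolding transpose_mult_index[OF P j j] by (intro sum.cong) (auto simp: P_eq j)
    also have "\<dots> = card (S j)" by (simp add: Int_def S_def)
    finally show ?thesis by simp
  qed
  \<comment> \<open>Termwise inequalities between families with the same sum \<open>n\<close> are
    equalities.\<close>
  have card_eq: "card (S j) = m j" if "j < k" for j
    using sum_mono_inv[of "\<lambda>j. card (S j)" "{..<k}" m j] sum_card sum_m card_le that by simp
  have S: "graph_partition n k m S" using cover disj card_eq by (simp add: graph_partition_def)
  have Xc: "X\<^sub>1 \<in> carrier_mat n n" using X1 by (simp add: sym_mats_def)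
  have Cc: "X\<^sub>1 - P * transpose_mat P \<in> carrier_mat n n" using P by (auto intro: minus_carrier_mat)
  \<comment> \<open>Both diagonals are one: that of \<open>X\<^sub>1\<close> by constraint, that of
    the product because each vertex shares a part with itself. Then \<open>psd_zero_diag\<close>
    removes the whole difference.\<close>
  have "(X\<^sub>1 - P * transpose_mat P) $$ (i, i) = 0" if i: "i < n" for i
  proof -
    have "X\<^sub>1 $$ (i, i) = 1"
      using arg_cong[OF diag, of "\<lambda>v. v $ i"] i Xc by (simp add: diag_vec_def ones_vec_def)
    moreover have "(P * transpose_mat P) $$ (i, i) = 1"
      using char_mat_mult_transpose[OF S i i] graph_partitionE[OF S i] by (auto simp: P_eq)
    ultimately show ?thesis using i P by simp
  qed
  then have "X\<^sub>1 - P * transpose_mat P = 0\<^sub>m n n" by (rule psd_zero_diag[OF C1 Cc])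
  then have zero: "(X\<^sub>1 - P * transpose_mat P) $$ (i, j) = 0" if "i < n" "j < n" for i j
    using that by simp
  have "X\<^sub>1 = P * transpose_mat P"
  proof (rule eq_matI)
    fix i j assume "i < dim_row (P * transpose_mat P)" "j < dim_col (P * transpose_mat P)"
    then show "X\<^sub>1 $$ (i, j) = (P * transpose_mat P) $$ (i, j)" using zero[of i j] P by simp
  qed (use P Xc in auto)
  then show ?thesis using that S P_eq by simp
qed

theorem proposition9:
  fixes n k :: nat and E :: "nat set set" and W :: "real mat" and m :: "nat \<Rightarrow> nat"
  assumes "undirected_graph n E"
    and "weight_matrix n E W"
    and "2 \<le> k" and "k \<le> n - 1"
    and "\<And>i j. i \<le> j \<Longrightarrow> j < k \<Longrightarrow> m j \<le> m i"
    and "\<And>j. j < k \<Longrightarrow> 1 \<le> m j"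
    and "(\<Sum>j<k. m j) = n"
  shows "exact_formulation (graph_partition n k m) (cut_weight E W k)
    (misdp_feasible n k m) (misdp_objective n W) (characteristic n k)"
  unfolding exact_formulation_def
proof (intro conjI allI impI)
  fix S assume S: "graph_partition n k m S"
  show "\<exists>x. misdp_feasible n k m x \<and> characteristic n k S x \<and> misdp_objective n W x = cut_weight E W k S"
  proof (intro exI conjI)
    \<comment> \<open>The point assigned to \<open>S\<close> makes both semidefinite constraints
      tight.\<close>
    show "misdp_feasible n k m (char_mat n k S,
      char_mat n k S * transpose_mat (char_mat n k S), Diag (vec k (\<lambda>j. real (m j))))"
      by (rule char_mat_feasible[OF S])
    show "misdp_objective n W (char_mat n k S,
      char_mat n k S * transpose_mat (char_mat n k S), Diag (vec k (\<lambda>j. real (m j)))) = cut_weight E W k S"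
      by (rule misdp_objective_char_mat[OF assms(2) S])
  qed (simp add: char_mat_def)
next
  fix x assume x: "misdp_feasible n k m x"
  obtain P X\<^sub>1 X\<^sub>2 where x_eq: "x = (P, X\<^sub>1, X\<^sub>2)" by (cases x)
  obtain S where S: "graph_partition n k m S" and P: "P = char_mat n k S"
    and X: "X\<^sub>1 = char_mat n k S * transpose_mat (char_mat n k S)"
    using feasible_imp_char_mat[OF x[unfolded x_eq] assms(7)] .
  have "misdp_objective n W x = cut_weight E W k S"
    unfolding x_eq X by (rule misdp_objective_char_mat[OF assms(2) S])
  moreover have "characteristic n k S x" by (simp add: x_eq P char_mat_def)
  ultimately show "\<exists>S. graph_partition n k m S \<and> characteristic n k S x \<and>
      cut_weight E W k S = misdp_objective n W x"
    using S by auto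
qed

end
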